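(* Let $X$ and $Y$ be paracompact Hausdorff spaces and let $f\colon X\to Y$ be a continuous map all of whose fibers $f^{-1}(y)$, $y\in Y$, are compact, and such that $W(f)\leq\aleph_0$. Then for every $n\geq 1$ the space $C^*(X,\mathbb{R}^n)$ of all bounded continuous functions from $X$ to $\mathbb{R}^n$, with the uniform convergence topology, contains a dense set of maps $g$ such that for every $y\in Y$ the restriction $g|f^{-1}(y)\colon f^{-1}(y)\to\mathbb{R}^n$ is both a Bing map and a Krasinkiewicz map.
   Context: All maps are continuous. The uniform convergence topology on $C^*(X,\mathbb{R}^n)$ is the topology generated by the metric $\sup_{x\in X}\|g(x)-h(x)\|$. The spaces $X$ and $Y$ are paracompact Hausdorff and need not be metrizable. $W(f)\leq\aleph_0$ means that there exists a continuous map $g\colon X\to\mathbb{I}^{\aleph_0}$ into the Hilbert cube $\mathbb{I}^{\aleph_0}=[0,1]^{\aleph_0}$ such that the diagonal map $f\triangle g\colon X\to Y\times\mathbb{I}^{\aleph_0}$, $x\mapsto (f(x),g(x))$, is a topological embedding. A compactum means a compact metrizable space. A continuum is a connected compactum; it is indecomposable if it is not the union of two proper subcontinua. A compactum is a Bing space if each of its subcontinua is indecomposable. A map $g\colon K\to\mathbb{R}^n$ with $K$ compact is a Bing map if all its fibers are Bing spaces; it is a Krasinkiewicz map if every continuum in $K$ is either contained in a fiber of $g$ or contains a connected component of a fiber of $g$. *)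

theory Defs
  imports "HOL-Analysis.Analysis"
begin

definition paracompact_space :: "'a topology \<Rightarrow> bool" where
  "paracompact_space X \<longleftrightarrow>
     (\<forall>\<U>. (\<forall>U\<in>\<U>. openin X U) \<and> \<Union>\<U> = topspace X \<longrightarrow>
        (\<exists>\<V>. (\<forall>V\<in>\<V>. openin X V) \<and> \<Union>\<V> = topspace X \<and>
             (\<forall>V\<in>\<V>. \<exists>U\<in>\<U>. V \<subseteq> U) \<and> locally_finite_in X \<V>))"

definition fiber :: "'a topology \<Rightarrow> ('a \<Rightarrow> 'b) \<Rightarrow> 'b \<Rightarrow> 'a set" where
  "fiber X f y = {x \<in> topspace X. f x = y}"

definition hilbert_cube :: "(nat \<Rightarrow> real) topology" where
  "hilbert_cube = product_topology (\<lambda>_. top_of_set {0..1}) UNIV"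

text \<open>The condition \<open>W(f) \<le> \<aleph>\<^sub>0\<close>.\<close>

definition W_le_aleph0 :: "'a topology \<Rightarrow> 'b topology \<Rightarrow> ('a \<Rightarrow> 'b) \<Rightarrow> bool" where
  "W_le_aleph0 X Y f \<longleftrightarrow>
     (\<exists>g. continuous_map X hilbert_cube g \<and>
          embedding_map X (prod_topology Y hilbert_cube) (\<lambda>x. (f x, g x)))"

definition compactum :: "'a topology \<Rightarrow> bool" where
  "compactum X \<longleftrightarrow> compact_space X \<and> metrizable_space X"

text \<open>Continua are nonempty. The notions below would be the same if the empty space
  were admitted: it is indecomposable, adds nothing to a union of two subcontinua, and as a
  subset lies in every fiber of a map into a nonempty space.\<close>

definition continuum :: "'a topology \<Rightarrow> bool" where
  "continuum X \<longleftrightarrow> compactum X \<and> connected_space X \<and> topspace X \<noteq> {}"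

definition subcontinuum :: "'a topology \<Rightarrow> 'a set \<Rightarrow> bool" where
  "subcontinuum X C \<longleftrightarrow> C \<subseteq> topspace X \<and> continuum (subtopology X C)"

definition indecomposable_continuum :: "'a topology \<Rightarrow> bool" where
  "indecomposable_continuum X \<longleftrightarrow> continuum X \<and>
     \<not> (\<exists>A B. subcontinuum X A \<and> A \<noteq> topspace X \<and>
              subcontinuum X B \<and> B \<noteq> topspace X \<and> A \<union> B = topspace X)"

definition Bing_space :: "'a topology \<Rightarrow> bool" where
  "Bing_space X \<longleftrightarrow> compactum X \<and>
     (\<forall>C. subcontinuum X C \<longrightarrow> indecomposable_continuum (subtopology X C))"

definition Bing_map :: "'a topology \<Rightarrow> ('a \<Rightarrow> real ^ 'n) \<Rightarrow> bool" where
  "Bing_map K g \<longleftrightarrow> compact_space K \<and> continuous_map K euclidean g \<and>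
     (\<forall>z. Bing_space (subtopology K (fiber K g z)))"

definition Krasinkiewicz_map :: "'a topology \<Rightarrow> ('a \<Rightarrow> real ^ 'n) \<Rightarrow> bool" where
  "Krasinkiewicz_map K g \<longleftrightarrow> compact_space K \<and> continuous_map K euclidean g \<and>
     (\<forall>C. subcontinuum K C \<longrightarrow>
        (\<exists>z. C \<subseteq> fiber K g z) \<or>
        (\<exists>z. \<exists>D \<in> connected_components_of (subtopology K (fiber K g z)). D \<subseteq> C))"

end

theory Submission
  imports Defs
begin

text \<open>
The hypothesis \<open>W(f) \<le> \<aleph>\<^sub>0\<close> supplies a map \<open>q\<close> from \<open>X\<close> into the Hilbert cube that is
injective on every fiber of \<open>f\<close>. As the cube is compact metrizable, countably many functions on
it, pulled back by \<open>q\<close>, give functions \<open>v i\<close> on all of \<open>X\<close> which on each (compact) fiber of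
\<open>f\<close> separate disjoint closed sets. So all fibers can be treated at
once, on \<open>X\<close>. It can also be done one coordinate of \<open>\<real>\<^sup>n\<close> at a time: fibers shrink when
coordinates are added, so one coordinate with hereditarily indecomposable fibers suffices; and if
a continuum is not contained in a fiber, then some coordinate is nonconstant on it, and a component
of a fiber of that coordinate contains components of fibers of the whole map.

A bounded function \<open>\<phi>\<close> is made crooked by infinitely many smaller and smaller corrections
\<open>h \<mapsto> e * crook (h / e) u\<close>, where \<open>crook s u = s + 2 - 4 * u + cos (2 * pi * s)\<close> and \<open>u\<close> runs
through the averages \<open>(v i + v j) / 2\<close>, each of them used at arbitrarily small scales \<open>e\<close>.
The scales decrease so fast that the later corrections do not exceed \<open>e / 8\<close>; thus the limit is,
at the scale \<open>e\<close>, still crooked in the direction of \<open>u\<close>. A property of \<open>crook\<close> on the strip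
\<open>\<real> \<times> [0,1]\<close> that survives an error of \<open>1 / 8\<close> is therefore inherited by the limit
(\<open>exists_crooked_approximation\<close>). Two such properties are used.

For the Bing property (\<open>crooked_fiber_nested\<close>): a level set of \<open>crook\<close> leads from the bottom
\<open>u = 0\<close> of the strip to the top \<open>u = 1\<close> only along an N-shaped path. On its way it rises above
\<open>u = 1/2\<close>, then falls below \<open>u = 1/2\<close>, and only then reaches the top. Hence a connected piece
\<open>A\<close> of the lower half of the level set that touches the bottom does not meet a connected piece \<open>B\<close> of
its upper half that touches the top. Two continua \<open>A\<close> and \<open>B\<close> in one fiber that meet, neither
inside the other, would yield just this, with a suitable \<open>u\<close>.

For the Krasinkiewicz property (\<open>crooked_island\<close>,
\<open>crooked_continuum_contains_component\<close>): seen from the bottom of the strip, \<open>crook\<close> has a ridge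
at each integer \<open>s\<close>, and the part of the ridge near the bottom is an island, surrounded by
lower values within \<open>u < 1\<close>. A continuum \<open>C\<close> in \<open>{v i = 0}\<close> on which the limit function
oscillates by more than \<open>10 * e\<close> has to climb over a ridge, and the components of fibers through
the points of \<open>C\<close> high on it do not get to \<open>{v i = 1}\<close>. These points contain a smaller
nondegenerate continuum, so that the argument can be repeated for all \<open>i\<close>; a point in the
intersection has its whole component inside \<open>C\<close>.
\<close>

section \<open>The crooked function of the strip\<close>

text \<open>The cosine folds the line, with a ridge at each integer \<open>j\<close> and a valley at \<open>j + 1/2\<close>,
and the term \<open>- 4 * u\<close> lowers the folded line as \<open>u\<close> grows. On the lower half of the strip
the ridge at \<open>j\<close> has height at least \<open>j + 1\<close>; on the upper half the valley at \<open>j + 1/2\<close> has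
height at most \<open>j - 1/2\<close>. So a level set of a value between \<open>j - 1/2\<close> and \<open>j + 1\<close> passes the ridge
only above \<open>u = 1/2\<close> and the valley only below it. These intervals are longer than the distance
1 of consecutive ones, hence each value has a \<open>j\<close>, with room for an error.\<close>

definition crook :: "real \<Rightarrow> real \<Rightarrow> real" where
  "crook s u = s + 2 - 4 * u + cos (2 * pi * s)"

lemma crook_obtain:
  obtains r where "-1 \<le> r" "r \<le> 1" "crook s u = s + 2 - 4 * u + r"
  using that[OF cos_ge_minus_one cos_le_one] by (simp add: crook_def)

lemma abs_crook_diff_le:
  assumes "0 \<le> u" "u \<le> 1"
  shows "\<bar>crook s u - s\<bar> \<le> 3"
proof -
  obtain r where "-1 \<le> r" "r \<le> 1" "crook s u = s + 2 - 4 * u + r"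
    using crook_obtain .
  then show ?thesis using assms by linarith
qed

lemma crook_of_int: "crook (of_int j) u = of_int j + 3 - 4 * u"
  using cos_int_2pin[of j] by (simp add: crook_def)

lemma crook_of_int_plus_half: "crook (of_int j + 1/2) u = of_int j + 3/2 - 4 * u"
proof -
  have "cos (2 * pi * (of_int j + 1/2)) = cos (2 * pi * of_int j + pi)"
    by (simp add: algebra_simps)
  also have "\<dots> = -1"
    using cos_int_2pin[of j] by simp
  finally show ?thesis by (simp add: crook_def)
qed

lemma crook_of_int_minus_half: "crook (of_int j - 1/2) u = of_int j + 1/2 - 4 * u"
  using crook_of_int_plus_half[of "j - 1" u] by simp

lemma crook_0_ge: "crook s 0 \<ge> s + 1"
  using crook_obtain[of s 0] by fastforce

lemma crook_1_le: "crook s 1 \<le> s - 1"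
  using crook_obtain[of s 1] by fastforce

lemma continuous_map_crook:
  assumes "continuous_map X euclideanreal s" "continuous_map X euclideanreal u"
  shows "continuous_map X euclideanreal (\<lambda>x. crook (s x) (u x))"
proof -
  have "continuous_map euclideanreal euclideanreal cos"
    by (simp add: continuous_on_cos)
  then have "continuous_map X euclideanreal (cos \<circ> (\<lambda>x. 2 * pi * s x))"
    using assms by (intro continuous_map_compose[of _ euclideanreal] continuous_intros) auto
  then show ?thesis
    unfolding crook_def o_def using assms by (intro continuous_intros) auto
qed

section \<open>Crooked functions on a space\<close>

text \<open>Two functions \<open>v i\<close> and \<open>v j\<close> are averaged because a three-valued separation is
needed in \<open>crooked_fiber_nested\<close>: 0 at a point of one set and at most \<open>1/2\<close> on all of it,
1 at a point of another set and at least \<open>1/2\<close> on all of that. The function \<open>s\<close>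
stands for the stage of the construction that precedes the correction at scale \<open>e\<close>, and \<open>e / 8\<close> bounds all later
corrections.\<close>

definition crooked :: "'a topology \<Rightarrow> (nat \<Rightarrow> 'a \<Rightarrow> real) \<Rightarrow> ('a \<Rightarrow> real) \<Rightarrow> bool" where
  "crooked X v g \<longleftrightarrow> continuous_map X euclideanreal g \<and>
     (\<forall>i j. \<forall>\<delta>>0. \<exists>e s. 0 < e \<and> e < \<delta> \<and> continuous_map X euclideanreal s \<and>
        (\<forall>x\<in>topspace X. \<bar>g x - e * crook (s x / e) ((v i x + v j x) / 2)\<bar> \<le> e / 8))"

lemma crookedE:
  assumes "crooked X v g" "0 < \<delta>"
  obtains e s where "0 < e" "e < \<delta>" "continuous_map X euclideanreal s"
    "\<And>x. x \<in> topspace X \<Longrightarrow> \<bar>g x - e * crook (s x / e) ((v i x + v j x) / 2)\<bar> \<le> e / 8"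
proof -
  have "\<exists>e s. 0 < e \<and> e < \<delta> \<and> continuous_map X euclideanreal s \<and>
        (\<forall>x\<in>topspace X. \<bar>g x - e * crook (s x / e) ((v i x + v j x) / 2)\<bar> \<le> e / 8)"
    using assms by (simp add: crooked_def)
  then show thesis using that by metis
qed

lemma crooked_eq:
  assumes "crooked X v g" "\<And>x. x \<in> topspace X \<Longrightarrow> g x = h x"
  shows "crooked X v h"
proof -
  have "continuous_map X euclideanreal h"
    using assms continuous_map_eq unfolding crooked_def by blast
  then show ?thesis using assms by (simp add: crooked_def)
qed

lemma crooked_subtopology:
  assumes "crooked X v g"
  shows "crooked (subtopology X S) v g"
  unfolding crooked_def
proof (intro conjI allI impI)
  show "continuous_map (subtopology X S) euclideanreal g"
    using assms by (simp add: crooked_def continuous_map_from_subtopology)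
  fix i j and \<delta> :: real assume "\<delta> > 0"
  then obtain e s where "0 < e" "e < \<delta>" "continuous_map X euclideanreal s"
    "\<forall>x\<in>topspace X. \<bar>g x - e * crook (s x / e) ((v i x + v j x) / 2)\<bar> \<le> e / 8"
    using assms unfolding crooked_def by blast
  then show "\<exists>e s. 0 < e \<and> e < \<delta> \<and> continuous_map (subtopology X S) euclideanreal s \<and>
        (\<forall>x\<in>topspace (subtopology X S).
          \<bar>g x - e * crook (s x / e) ((v i x + v j x) / 2)\<bar> \<le> e / 8)"
    by (intro exI[of _ e] exI[of _ s]) (auto simp: continuous_map_from_subtopology)
qed

text \<open>The corrections are at most \<open>3 * e\<close> at scale \<open>e\<close>, so scales with ratio \<open>1 / 32\<close> make the
sum of all later ones less than \<open>e / 8\<close>. The stages are uniformly Cauchy on \<open>X\<close>, hence the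
limit is continuous.\<close>

lemma exists_crooked_approximation:
  assumes \<phi>: "continuous_map X euclideanreal \<phi>"
    and v: "\<And>i. continuous_map X euclideanreal (v i)"
    and v01: "\<And>i x. x \<in> topspace X \<Longrightarrow> v i x \<in> {0..1}"
    and "c > 0"
  obtains g where "crooked X v g" "\<And>x. x \<in> topspace X \<Longrightarrow> \<bar>g x - \<phi> x\<bar> \<le> c"
proof -
  define e :: "nat \<Rightarrow> real" where "e k = c / 4 / 32 ^ k" for k
  have e_pos: "e k > 0" for k using \<open>c > 0\<close> by (simp add: e_def)
  have e_Suc: "e (Suc k) = e k / 32" for k by (simp add: e_def)
  define u where "u k x = (let (i, l) = prod_decode k; (i, j) = prod_decode i
                           in (v i x + v j x) / 2)" for k x
  define h where "h = rec_nat \<phi> (\<lambda>k s x. e k * crook (s x / e k) (u k x))"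
  have h_0: "h 0 = \<phi>" and
    h_Suc: "h (Suc k) = (\<lambda>x. e k * crook (h k x / e k) (u k x))" for k
    by (simp_all add: h_def)
  have u_cont: "continuous_map X euclideanreal (u k)" for k
    unfolding u_def Let_def case_prod_beta using v by (intro continuous_intros) auto
  have u01: "0 \<le> u k x" "u k x \<le> 1" if "x \<in> topspace X" for k x
  proof -
    have "0 \<le> (v i x + v j x) / 2" "(v i x + v j x) / 2 \<le> 1" for i j
      using v01[OF that, of i] v01[OF that, of j] by auto
    then show "0 \<le> u k x" "u k x \<le> 1"
      by (simp_all only: u_def Let_def case_prod_beta)
  qed
  have h_cont: "continuous_map X euclideanreal (h k)" for k
  proof (induction k)
    case 0 then show ?case using \<phi> by (simp add: h_0)
  next
    case (Suc k)
    show ?case unfolding h_Suc using Suc u_cont e_pos[of k]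
      by (intro continuous_intros continuous_map_crook) auto
  qed
  have step: "\<bar>h (Suc k) x - h k x\<bar> \<le> 3 * e k" if "x \<in> topspace X" for k x
  proof -
    have "h (Suc k) x - h k x = e k * (crook (h k x / e k) (u k x) - h k x / e k)"
      using e_pos[of k] by (simp add: h_Suc algebra_simps)
    then show ?thesis
      using abs_crook_diff_le[OF u01[OF that, of k], of "h k x / e k"] e_pos[of k]
      by (simp add: abs_mult)
  qed
  \<comment> \<open>The constant is chosen so that the bound for all later steps, as the sum of a geometric
    series of ratio 1/32, reproduces itself: 3 + (96/31)/32 = 96/31.\<close>
  have tail: "\<bar>h (k + m) x - h k x\<bar> \<le> 96 / 31 * e k" if "x \<in> topspace X" for k m x
  proof (induction m arbitrary: k)
    case 0 then show ?case using e_pos[of k] by simp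
  next
    case (Suc m)
    have "\<bar>h (Suc k + m) x - h (Suc k) x\<bar> \<le> 3 / 31 * e k"
      using Suc[of "Suc k"] by (simp add: e_Suc)
    then show ?case using step[OF that, of k]
      unfolding abs_le_iff add_Suc add_Suc_right by linarith
  qed
  have e_lim: "(\<lambda>k. C * e k) \<longlonglongrightarrow> 0" for C
  proof -
    have "(\<lambda>k. C * (c / 4) * (1 / 32) ^ k) \<longlonglongrightarrow> C * (c / 4) * 0"
      by (intro tendsto_intros LIMSEQ_power_zero) auto
    then show ?thesis by (simp add: e_def power_one_over divide_simps)
  qed
  have e_small: "\<exists>N. \<forall>k\<ge>N. C * e k < r" if "r > 0" for C r
    using order_tendstoD(2)[OF e_lim that, of C] by (simp add: eventually_sequentially)
  have conv: "convergent (\<lambda>k. h k x)" if "x \<in> topspace X" for x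
  proof -
    have "Cauchy (\<lambda>k. h k x)"
      unfolding Cauchy_altdef2
    proof (intro allI impI)
      fix r :: real assume "r > 0"
      then obtain N where "96 / 31 * e N < r" using e_small by blast
      then have "dist (h n x) (h N x) < r" if "n \<ge> N" for n
        using tail[OF \<open>x \<in> topspace X\<close>, of N "n - N"] that by (simp add: dist_real_def)
      then show "\<exists>N. \<forall>n\<ge>N. dist (h n x) (h N x) < r" by blast
    qed
    then show ?thesis by (simp add: Cauchy_convergent_iff)
  qed
  define g where "g x = lim (\<lambda>k. h k x)" for x
  have g_near: "\<bar>g x - h k x\<bar> \<le> 96 / 31 * e k" if "x \<in> topspace X" for k x
  proof (rule tendsto_upperbound)
    have "(\<lambda>m. h m x) \<longlonglongrightarrow> g x" using conv[OF that] by (simp add: g_def convergent_LIMSEQ_iff)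
    then have "(\<lambda>m. h (m + k) x) \<longlonglongrightarrow> g x" by (rule LIMSEQ_ignore_initial_segment)
    then show "(\<lambda>m. \<bar>h (m + k) x - h k x\<bar>) \<longlonglongrightarrow> \<bar>g x - h k x\<bar>"
      by (intro tendsto_intros)
  qed (use tail[OF that, of k] in \<open>auto simp: add.commute\<close>)
  have "continuous_map X euclideanreal g"
    unfolding mtopology_is_euclidean[symmetric]
  proof (rule Met_TC.continuous_map_uniform_limit)
    show "\<forall>\<^sub>F k in sequentially. continuous_map X Met_TC.mtopology (h k)"
      using h_cont by simp
    show "\<forall>\<^sub>F k in sequentially. \<forall>x\<in>topspace X. g x \<in> UNIV \<and> dist (h k x) (g x) < r"
      if r: "r > 0" for r
    proof -
      obtain N where N: "\<And>k. k \<ge> N \<Longrightarrow> 96 / 31 * e k < r" using e_small[OF r] by blast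
      have "dist (h k x) (g x) < r" if "k \<ge> N" "x \<in> topspace X" for k x
        using g_near[OF that(2), of k] N[OF that(1)] unfolding dist_real_def by linarith
      then show ?thesis unfolding eventually_sequentially by blast
    qed
  qed simp
  moreover have "\<exists>r s. 0 < r \<and> r < \<delta> \<and> continuous_map X euclideanreal s \<and>
        (\<forall>x\<in>topspace X. \<bar>g x - r * crook (s x / r) ((v i x + v j x) / 2)\<bar> \<le> r / 8)"
    if \<delta>: "\<delta> > 0" for i j \<delta>
  proof -
    obtain N where N: "\<And>k. k \<ge> N \<Longrightarrow> e k < \<delta>" using e_small[OF \<delta>, of 1] unfolding mult_1 by blast
    \<comment> \<open>Each pair recurs at arbitrarily late stages.\<close>
    define k where "k = prod_encode (prod_encode (i, j), N)"
    have "k \<ge> N" by (simp add: k_def le_prod_encode_2)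
    have "u k = (\<lambda>x. (v i x + v j x) / 2)" by (rule ext) (simp add: k_def u_def)
    then have *: "h (Suc k) x = e k * crook (h k x / e k) ((v i x + v j x) / 2)" for x
      by (simp add: h_Suc)
    have "\<bar>g x - e k * crook (h k x / e k) ((v i x + v j x) / 2)\<bar> \<le> e k / 8"
      if "x \<in> topspace X" for x
      using g_near[OF that, of "Suc k"] e_pos[of k] unfolding * e_Suc by linarith
    then show ?thesis using e_pos N[OF \<open>k \<ge> N\<close>] h_cont by blast
  qed
  ultimately have "crooked X v g" unfolding crooked_def by blast
  moreover have "\<bar>g x - \<phi> x\<bar> \<le> c" if "x \<in> topspace X" for x
    using g_near[OF that, of 0] \<open>c > 0\<close> by (simp add: h_0 e_def)
  ultimately show thesis using that by blast
qed

section \<open>Fibers of crooked functions\<close>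

definition separates_closed_sets :: "'a topology \<Rightarrow> (nat \<Rightarrow> 'a \<Rightarrow> real) \<Rightarrow> bool" where
  "separates_closed_sets K v \<longleftrightarrow>
     (\<forall>i. continuous_map K euclideanreal (v i) \<and> v i \<in> topspace K \<rightarrow> {0..1}) \<and>
     (\<forall>P R. closedin K P \<and> closedin K R \<and> P \<noteq> {} \<and> R \<noteq> {} \<and> disjnt P R \<longrightarrow>
        (\<exists>i. (\<forall>x\<in>P. v i x = 0) \<and> (\<forall>x\<in>R. v i x = 1)))"

lemma separates_closed_setsE:
  assumes "separates_closed_sets K v" "closedin K P" "closedin K R" "P \<noteq> {}" "R \<noteq> {}" "disjnt P R"
  obtains i where "\<And>x. x \<in> P \<Longrightarrow> v i x = 0" "\<And>x. x \<in> R \<Longrightarrow> v i x = 1"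
proof -
  have "\<exists>i. (\<forall>x\<in>P. v i x = 0) \<and> (\<forall>x\<in>R. v i x = 1)"
    using assms by (simp add: separates_closed_sets_def)
  then show thesis using that by metis
qed

lemma connectedin_avoids_value:
  fixes s :: "'a \<Rightarrow> real"
  assumes "continuous_map X euclideanreal s" "connectedin X S"
    and "x \<in> S" "s x < a" "\<And>z. z \<in> S \<Longrightarrow> s z \<noteq> a" "y \<in> S"
  shows "s y < a"
proof (rule ccontr)
  assume "\<not> s y < a"
  have "connected (s ` S)"
    using connectedin_continuous_map_image[OF assms(1,2)] by (simp add: connectedin_iff_connected)
  then have "a \<in> s ` S"
    using assms(3,4,6) \<open>\<not> s y < a\<close> connectedD_interval[of "s ` S" "s x" "s y" a] by auto
  then show False using assms(5) by auto
qed

text \<open>If \<open>a \<in> A - B\<close> and \<open>b \<in> B - A\<close>, the average of a function that is 0 on \<open>A\<close> and 1 at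
\<open>b\<close> with one that is 0 at \<open>a\<close> and 1 on \<open>B\<close> maps \<open>A\<close> into \<open>[0, 1/2]\<close>, \<open>B\<close> into
\<open>[1/2, 1]\<close>, \<open>a\<close> to 0 and \<open>b\<close> to 1. At a scale of this average, the level of the fiber keeps
\<open>A\<close> to the left of the line \<open>s = n\<close> and \<open>B\<close> to the right of the line \<open>s = n + 1/2\<close>.\<close>

lemma crooked_fiber_nested:
  assumes v: "separates_closed_sets K v" and g: "crooked K v g" and "t1_space K"
    and A: "closedin K A" "connectedin K A" and B: "closedin K B" "connectedin K B"
    and "A \<inter> B \<noteq> {}" and t: "\<And>x. x \<in> A \<union> B \<Longrightarrow> g x = t"
  shows "A \<subseteq> B \<or> B \<subseteq> A"
proof (rule ccontr)
  assume "\<not> (A \<subseteq> B \<or> B \<subseteq> A)"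
  then obtain a b where a: "a \<in> A" "a \<notin> B" and b: "b \<in> B" "b \<notin> A" by blast
  have sub: "A \<subseteq> topspace K" "B \<subseteq> topspace K" using A B by (auto dest: closedin_subset)
  have "closedin K {a}" "closedin K {b}"
    using \<open>t1_space K\<close> a b sub by (auto simp: t1_space_closedin_singleton)
  obtain i where i: "\<And>x. x \<in> A \<Longrightarrow> v i x = 0" "v i b = 1"
    using separates_closed_setsE[OF v A(1) \<open>closedin K {b}\<close>] a b by auto
  obtain j where j: "v j a = 0" "\<And>x. x \<in> B \<Longrightarrow> v j x = 1"
    using separates_closed_setsE[OF v \<open>closedin K {a}\<close> B(1)] a b by auto
  have v01: "0 \<le> v k x" "v k x \<le> 1" if "x \<in> topspace K" for k x
    using v that unfolding separates_closed_sets_def by (auto simp: Pi_iff)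
  define u where "u x = (v i x + v j x) / 2" for x
  \<comment> \<open>Any scale serves here, since \<open>g\<close> is constant on \<open>A \<union> B\<close>.\<close>
  obtain e s where "e > 0" and s: "continuous_map K euclideanreal s"
    and near: "\<And>x. x \<in> topspace K \<Longrightarrow> \<bar>g x - e * crook (s x / e) (u x)\<bar> \<le> e / 8"
    using crookedE[OF g zero_less_one] unfolding u_def by blast
  define S where "S x = s x / e" for x
  have S: "continuous_map K euclideanreal S"
    unfolding S_def using s \<open>e > 0\<close> by (intro continuous_intros) auto
  define \<tau> where "\<tau> = t / e"
  have near': "\<bar>\<tau> - crook (S x) (u x)\<bar> \<le> 1 / 8" if "x \<in> A \<union> B" for x
  proof -
    have "g x = t" "x \<in> topspace K" using t that sub by auto
    then have "\<bar>t - e * crook (S x) (u x)\<bar> \<le> e / 8" using near[of x] by (simp add: S_def)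
    moreover have "t - e * crook (S x) (u x) = e * (\<tau> - crook (S x) (u x))"
      using \<open>e > 0\<close> by (simp add: \<tau>_def algebra_simps)
    ultimately show ?thesis using \<open>e > 0\<close> by (simp add: abs_mult)
  qed
  \<comment> \<open>Any level \<open>\<tau>\<close> lies, with a margin above 1/8, between the bounds j - 1/2 and j + 1
    of some fold j.\<close>
  define n where "n = \<lfloor>\<tau> + 1/4\<rfloor>"
  have n: "of_int n - 1/4 \<le> \<tau>" "\<tau> < of_int n + 3/4"
    unfolding n_def by linarith+
  have "S x < of_int n" if "x \<in> A" for x
  proof (rule connectedin_avoids_value[OF S A(2) a(1) _ _ that])
    have "u a = 0" using i(1) j(1) a by (simp add: u_def)
    then have "crook (S a) (u a) \<ge> S a + 1" using crook_0_ge by simp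
    then show "S a < of_int n" using near'[OF UnI1, OF a(1)] n unfolding abs_le_iff by linarith
    show "S z \<noteq> of_int n" if "z \<in> A" for z
    proof
      assume "S z = of_int n"
      moreover have "u z \<le> 1/2" using i(1)[OF that] v01[of z j] that sub by (auto simp: u_def)
      ultimately have "crook (S z) (u z) \<ge> of_int n + 1" by (simp add: crook_of_int)
      then show False using near'[OF UnI1, OF that] n unfolding abs_le_iff by linarith
    qed
  qed
  moreover have "S x > of_int n + 1/2" if "x \<in> B" for x
  proof -
    have "- S x < - (of_int n + 1/2)"
    proof (rule connectedin_avoids_value[OF _ B(2) b(1) _ _ that])
      show "continuous_map K euclideanreal (\<lambda>x. - S x)" using S by (intro continuous_intros)
      have "u b = 1" using i(2) j(2) b by (simp add: u_def)
      then have "crook (S b) (u b) \<le> S b - 1" using crook_1_le by simp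
      then show "- S b < - (of_int n + 1/2)" using near'[OF UnI2, OF b(1)] n unfolding abs_le_iff by linarith
      show "- S z \<noteq> - (of_int n + 1/2)" if "z \<in> B" for z
      proof
        assume "- S z = - (of_int n + 1/2)"
        then have "S z = of_int n + 1/2" by linarith
        moreover have "u z \<ge> 1/2" using j(2)[OF that] v01[of z i] that sub by (auto simp: u_def)
        ultimately have "crook (S z) (u z) \<le> of_int n - 1/2" by (simp add: crook_of_int_plus_half)
        then show False using near'[OF UnI2, OF that] n unfolding abs_le_iff by linarith
      qed
    qed
    then show ?thesis by simp
  qed
  ultimately show False using \<open>A \<inter> B \<noteq> {}\<close> by fastforce
qed

text \<open>The continuum \<open>C'\<close> is the component, in the part of \<open>C\<close> above a threshold between two
adjacent valleys, of a point on the ridge. By boundary bumping it reaches down to the threshold,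
hence \<open>g\<close> is not constant on it and the lemma can be applied again to \<open>C'\<close>. A connected subset of
a fiber that meets \<open>C'\<close> stays above the threshold, so it cannot cross the valleys, and between
them it cannot reach \<open>v i = 1\<close>, where all values are low.\<close>

lemma crooked_island:
  assumes v: "separates_closed_sets K v" and g: "crooked K v g"
    and K: "compact_space K" "Hausdorff_space K"
    and C: "closedin K C" "connectedin K C" and nonconst: "\<not> g constant_on C"
    and v0: "\<And>x. x \<in> C \<Longrightarrow> v i x = 0"
  obtains C' where "C' \<subseteq> C" "closedin K C'" "connectedin K C'" "\<not> g constant_on C'"
    "\<And>x D y. \<lbrakk>x \<in> C'; connectedin K D; x \<in> D; g constant_on D; y \<in> D\<rbrakk> \<Longrightarrow> v i y \<noteq> 1"
proof -
  have C_sub: "C \<subseteq> topspace K" using C by (auto dest: closedin_subset)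
  obtain p q where pq: "p \<in> C" "q \<in> C" "g p < g q"
    using nonconst unfolding constant_on_def by (metis linorder_neqE_linordered_idom)
  have v01: "0 \<le> v i x" "v i x \<le> 1" if "x \<in> topspace K" for x
    using v that unfolding separates_closed_sets_def by (auto simp: Pi_iff)
  \<comment> \<open>As \<open>g\<close> and \<open>s\<close> differ by at most \<open>(3 + 1/8) * e\<close>, a variation of \<open>g\<close> beyond \<open>10 * e\<close>
    makes \<open>s\<close> vary by more than \<open>2 * e\<close> and so pass over a full period of the cosine that is
    centered at a ridge.\<close>
  have "(g q - g p) / 10 > 0" using pq by simp
  then obtain e s where "e > 0" and e: "e < (g q - g p) / 10" and s: "continuous_map K euclideanreal s"
    and near: "\<And>x. x \<in> topspace K \<Longrightarrow> \<bar>g x - e * crook (s x / e) ((v i x + v i x) / 2)\<bar> \<le> e / 8"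
    using crookedE[OF g, where i = i and j = i] by blast
  define S where "S x = s x / e" for x
  define G where "G x = g x / e" for x
  have S: "continuous_map K euclideanreal S"
    unfolding S_def using s \<open>e > 0\<close> by (intro continuous_intros) auto
  have G: "continuous_map K euclideanreal G"
    unfolding G_def using g \<open>e > 0\<close> by (intro continuous_intros) (auto simp: crooked_def)
  have near': "\<bar>G x - crook (S x) (v i x)\<bar> \<le> 1 / 8" if "x \<in> topspace K" for x
  proof -
    have "g x - e * crook (S x) (v i x) = e * (G x - crook (S x) (v i x))"
      using \<open>e > 0\<close> by (simp add: G_def algebra_simps)
    then show ?thesis using near[OF that] \<open>e > 0\<close> by (simp add: abs_mult S_def)
  qed
  have "G q - G p > 10" using e \<open>e > 0\<close> by (simp add: G_def field_simps)
  moreover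
  have "\<bar>G x - S x\<bar> \<le> 25 / 8" if "x \<in> topspace K" for x
    using near'[OF that] abs_crook_diff_le[OF v01[OF that], of "S x"] by linarith
  then have "\<bar>G p - S p\<bar> \<le> 25 / 8" "\<bar>G q - S q\<bar> \<le> 25 / 8"
    using pq C_sub by blast+
  ultimately have pqS: "S q - S p > 2" by linarith
  define j where "j = \<lceil>S p + 1/2\<rceil>"
  have j: "S p \<le> of_int j - 1/2" "of_int j + 1/2 \<le> S q"
    unfolding j_def using pqS by linarith+
  have "connected (S ` C)"
    using connectedin_continuous_map_image[OF S C(2)] by (simp add: connectedin_iff_connected)
  then have mid: "r \<in> S ` C" if "S p \<le> r" "r \<le> S q" for r
    using that pq connectedD_interval[of "S ` C" "S p" "S q" r] by auto
  obtain x0 where x0: "x0 \<in> C" "S x0 = of_int j" using mid[of "of_int j"] j by auto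
  obtain x1 where x1: "x1 \<in> C" "S x1 = of_int j + 1/2" using mid[of "of_int j + 1/2"] j by auto
  \<comment> \<open>The threshold of the island: on its boundary G is at most j + 3/2 + 1/8, on its summit
    at least j + 3 - 1/8.\<close>
  define c where "c = of_int j + (9/4 :: real)"
  have wall: "G x < c" if "x \<in> topspace K" "S x = of_int j - 1/2 \<or> S x = of_int j + 1/2" for x
  proof -
    have "crook (S x) (v i x) \<le> of_int j + 3/2"
      using that(2) v01(1)[OF that(1)]
      by (elim disjE) (simp_all add: crook_of_int_plus_half crook_of_int_minus_half)
    then show ?thesis using near'[OF that(1)] unfolding c_def by linarith
  qed
  have summit: "G x0 > c"
  proof -
    have "crook (S x0) (v i x0) = of_int j + 3" "x0 \<in> topspace K"
      using x0 v0 C_sub by (auto simp: crook_of_int)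
    then show ?thesis using near'[of x0] unfolding c_def by linarith
  qed
  define T where "T = {x \<in> topspace K. S x \<in> {of_int j - 1/2..of_int j + 1/2}} \<inter>
                      {x \<in> topspace K. G x \<in> {c..}}"
  have "closedin K T" unfolding T_def
    by (intro closedin_Int closedin_continuous_map_preimage[OF S]
        closedin_continuous_map_preimage[OF G]) auto
  define L where "L = subtopology K C"
  have L_top: "topspace L = C" using C_sub by (auto simp: L_def)
  have CT: "closedin L (C \<inter> T)"
    unfolding L_def using \<open>closedin K T\<close> by (simp add: closedin_subtopology_Int_closed)
  have "C \<inter> T \<noteq> C" 
  proof
    assume "C \<inter> T = C"
    then have "x1 \<in> T" using x1 by blast
    then show False using wall[of x1] x1 by (auto simp: T_def)
  qed
  define C' where "C' = connected_component_of_set (subtopology L (C \<inter> T)) x0"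
  have x0T: "x0 \<in> C \<inter> T" using x0 summit C_sub by (auto simp: T_def)
  then have comp: "C' \<in> connected_components_of (subtopology L (C \<inter> T))"
    unfolding C'_def connected_components_of_def using L_top by auto
  have sub: "C' \<subseteq> C \<inter> T"
    using connected_components_of_subset[OF comp] by auto
  have "x0 \<in> C'" using x0T L_top by (simp add: C'_def connected_component_of_refl)
  have "C' \<inter> L frontier_of (C \<inter> T) \<noteq> {}"
  proof (rule boundary_bumping_theorem_closed)
    show "connected_space L" using C by (simp add: L_def connectedin_def)
    show "compact_space L" using C K
      by (simp add: L_def closedin_compact_space compact_space_subtopology)
    show "Hausdorff_space L" using K by (simp add: L_def Hausdorff_space_subtopology)
  qed (use CT \<open>C \<inter> T \<noteq> C\<close> comp L_top in auto)
  then obtain y where y: "y \<in> C'" "y \<in> L frontier_of (C \<inter> T)" by blast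
  have "G y = c"
  proof (rule ccontr)
    assume "G y \<noteq> c"
    define U where "U = {x \<in> topspace K. S x \<in> {of_int j - 1/2<..<of_int j + 1/2}} \<inter>
                        {x \<in> topspace K. G x \<in> {c<..}}"
    have "openin K U" unfolding U_def
      by (intro openin_Int openin_continuous_map_preimage[OF S]
          openin_continuous_map_preimage[OF G]) auto
    then have "openin L (C \<inter> U)" by (simp add: L_def openin_subtopology_Int2)
    moreover have "C \<inter> U \<subseteq> C \<inter> T" by (auto simp: U_def T_def)
    moreover have "y \<in> C \<inter> U"
      using y(1) sub \<open>G y \<noteq> c\<close> wall[of y] by (fastforce simp: U_def T_def)
    ultimately have "y \<in> L interior_of (C \<inter> T)" by (meson interior_of_maximal subsetD)
    then show False using y(2) by (simp add: frontier_of_def)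
  qed
  show thesis
  proof
    show "C' \<subseteq> C" using sub by blast
    show "closedin K C'"
      using closedin_connected_components_of[OF comp] CT C(1) unfolding L_def
      by (meson closedin_trans_full)
    show "connectedin K C'"
      using connectedin_connected_components_of[OF comp]
      by (simp add: L_def connectedin_subtopology)
    show "\<not> g constant_on C'"
      using \<open>x0 \<in> C'\<close> y(1) \<open>G y = c\<close> summit unfolding constant_on_def G_def
      by (metis less_irrefl)
    show "v i y \<noteq> 1"
      if x: "x \<in> C'" and D: "connectedin K D" "x \<in> D" "g constant_on D" and y: "y \<in> D" for x D y
    proof
      assume "v i y = 1"
      have D_sub: "D \<subseteq> topspace K" using D by (simp add: connectedin_def)
      have level: "G z \<ge> c" if "z \<in> D" for z
      proof -
        have "G z = G x" using D that unfolding constant_on_def G_def by metis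
        then show ?thesis using x sub by (auto simp: T_def)
      qed
      have avoid: "S z \<noteq> of_int j + 1/2" if "z \<in> D" for z
        using level[OF that] wall[of z] that D_sub by fastforce
      have "S x \<le> of_int j + 1/2" using x sub by (auto simp: T_def)
      then have "S x < of_int j + 1/2" using avoid[OF D(2)] by simp
      then have "S y < of_int j + 1/2"
        by (rule connectedin_avoids_value[OF S D(1,2) _ avoid y])
      moreover have "crook (S y) (v i y) \<le> S y - 1"
        using crook_1_le \<open>v i y = 1\<close> by simp
      moreover have "\<bar>G y - crook (S y) (v i y)\<bar> \<le> 1 / 8" using near' y D_sub by blast
      ultimately show False using level[OF y] unfolding c_def by linarith
    qed
  qed
qed

text \<open>If a connected \<open>D\<close> through \<open>x\<close> had a point \<open>y\<close> outside \<open>C\<close>, some \<open>v n\<close> would be 0 on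
\<open>C\<close> and 1 at \<open>y\<close>. Passing to an island for each such \<open>n\<close> in turn excludes all \<open>D\<close> of this kind
for the points \<open>x\<close> that survive every step, and by compactness there are such points.\<close>

lemma crooked_continuum_contains_component:
  assumes v: "separates_closed_sets K v" and g: "crooked K v g"
    and K: "compact_space K" "Hausdorff_space K"
    and C: "closedin K C" "connectedin K C" and nonconst: "\<not> g constant_on C"
  obtains x where "x \<in> C"
    "\<And>D. \<lbrakk>connectedin K D; x \<in> D; g constant_on D\<rbrakk> \<Longrightarrow> D \<subseteq> C"
proof -
  \<comment> \<open>\<open>P\<close> is what the nested sequence preserves, and \<open>Q n\<close> is what its step \<open>n\<close> achieves.\<close>
  define P where "P S \<longleftrightarrow> S \<subseteq> C \<and> closedin K S \<and> connectedin K S \<and> \<not> g constant_on S" for S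
  define Q where "Q n S \<longleftrightarrow> ((\<forall>x\<in>C. v n x = 0) \<longrightarrow>
      (\<forall>x\<in>S. \<forall>D. connectedin K D \<longrightarrow> x \<in> D \<longrightarrow> g constant_on D \<longrightarrow> (\<forall>y\<in>D. v n y \<noteq> 1)))" for n S
  have ex: "\<exists>S'. P S' \<and> S' \<subseteq> S \<and> Q n S'" if "P S" for S n
  proof (cases "\<forall>x\<in>C. v n x = 0")
    case True
    then have S0: "\<And>x. x \<in> S \<Longrightarrow> v n x = 0" using that by (auto simp: P_def)
    have S: "closedin K S" "connectedin K S" "\<not> g constant_on S"
      using that by (auto simp: P_def)
    obtain S' where "S' \<subseteq> S" "closedin K S'" "connectedin K S'" "\<not> g constant_on S'"
      "\<And>x D y. \<lbrakk>x \<in> S'; connectedin K D; x \<in> D; g constant_on D; y \<in> D\<rbrakk> \<Longrightarrow> v n y \<noteq> 1"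
      using crooked_island[OF v g K S S0] by blast
    then show ?thesis using that unfolding P_def Q_def by blast
  next
    case False
    then show ?thesis using that by (auto simp: Q_def)
  qed
  have "P C" using C nonconst by (simp add: P_def)
  then have "\<exists>F. \<forall>n. P (F n) \<and> F (Suc n) \<subseteq> F n \<and> Q n (F (Suc n))"
    using ex by (intro dependent_nat_choice[of "\<lambda>n. P" "\<lambda>n S S'. S' \<subseteq> S \<and> Q n S'"]) blast+
  then obtain F where F: "\<And>n. P (F n)"
    and FS: "\<And>n. F (Suc n) \<subseteq> F n \<and> Q n (F (Suc n))"
    by blast
  have "(\<Inter>n. F n) \<noteq> {}"
  proof (rule compact_space_imp_nest[OF K(1)])
    show "closedin K (F n)" "F n \<noteq> {}" for n
      using F[of n] by (auto simp: P_def constant_on_def)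
    show "decseq F" using FS by (simp add: decseq_SucI)
  qed
  then obtain x where x: "\<And>n. x \<in> F n" by blast
  have "x \<in> C" using x[of 0] F[of 0] by (auto simp: P_def)
  show thesis
  proof
    show "x \<in> C" by fact
    show "D \<subseteq> C" if D: "connectedin K D" "x \<in> D" "g constant_on D" for D
    proof
      fix y assume "y \<in> D"
      show "y \<in> C"
      proof (rule ccontr)
        assume "y \<notin> C"
        have "closedin K {y}"
          using K D \<open>y \<in> D\<close> connectedin_subset_topspace Hausdorff_imp_t1_space
          by (metis subsetD t1_space_closedin_singleton)
        then obtain n where "\<And>x. x \<in> C \<Longrightarrow> v n x = 0" "v n y = 1"
          using separates_closed_setsE[OF v C(1) \<open>closedin K {y}\<close>] \<open>y \<notin> C\<close> \<open>x \<in> C\<close> by auto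
        then show False using FS[of n] x[of "Suc n"] D \<open>y \<in> D\<close> unfolding Q_def by blast
      qed
    qed
  qed
qed

section \<open>A countable family of separating functions\<close>

text \<open>The functions are truncated multiples of the distance to a finite subset of a countable dense
set: a compact set is covered by small balls around finitely many points of the dense set, and a
compact set disjoint from it stays away from these points.\<close>

lemma exists_separating_functions:
  obtains w :: "nat \<Rightarrow> 'm::{metric_space, second_countable_topology} \<Rightarrow> real"
  where "\<And>i. continuous_on UNIV (w i)" "\<And>i x. w i x \<in> {0..1}"
    "\<And>P R. \<lbrakk>compact P; compact R; P \<noteq> {}; R \<noteq> {}; P \<inter> R = {}\<rbrakk>
       \<Longrightarrow> \<exists>i. (\<forall>x\<in>P. w i x = 0) \<and> (\<forall>x\<in>R. w i x = 1)"
proof -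
  obtain D :: "'m set" where "countable D" and D: "\<And>X. open X \<Longrightarrow> X \<noteq> {} \<Longrightarrow> \<exists>d\<in>D. d \<in> X"
    using countable_dense_exists by blast
  define \<F> where "\<F> = {S. finite S \<and> S \<subseteq> D} \<times> (UNIV :: nat set)"
  have "countable \<F>" "\<F> \<noteq> {}"
    using \<open>countable D\<close> by (auto simp: \<F>_def intro: countable_Collect_finite_subset)
  define f where "f = (\<lambda>(S, n). \<lambda>x :: 'm. max 0 (min 1 (infdist x S * real (Suc n) - 1)))"
  define w where "w i = f (from_nat_into \<F> i)" for i
  show thesis
  proof
    show "continuous_on UNIV (w i)" for i
      by (auto simp: w_def f_def split: prod.split intro!: continuous_intros)
    show "w i x \<in> {0..1}" for i x
      by (auto simp: w_def f_def split: prod.split)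
    fix P R :: "'m set"
    assume PR: "compact P" "compact R" "P \<noteq> {}" "R \<noteq> {}" "P \<inter> R = {}"
    have "continuous_on P (\<lambda>x. infdist x R)" by (intro continuous_intros)
    then obtain p0 where p0: "p0 \<in> P" "\<And>p. p \<in> P \<Longrightarrow> infdist p0 R \<le> infdist p R"
      using continuous_attains_inf[OF PR(1,3)] by blast
    define d where "d = infdist p0 R"
    have "d > 0" unfolding d_def
      using PR p0 by (intro infdist_pos_not_in_closed compact_imp_closed) auto
    have d: "d \<le> dist x y" if "x \<in> P" "y \<in> R" for x y
      using p0(2)[OF that(1)] infdist_le[OF that(2), of x] by (simp add: d_def)
    obtain n where n: "inverse (real (Suc n)) < d / 3"
      using reals_Archimedean[of "d / 3"] \<open>d > 0\<close> by auto
    define N where "N = real (Suc n)"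
    define r where "r = inverse N"
    have "r > 0" "r < d / 3" "r * N = 1" using n by (auto simp: r_def N_def)
    define A where "A = {s \<in> D. \<exists>p\<in>P. dist s p < r}"
    have "P \<subseteq> (\<Union>s\<in>A. ball s r)"
    proof
      fix p assume "p \<in> P"
      obtain s where "s \<in> D" "s \<in> ball p r" using D[of "ball p r"] \<open>r > 0\<close> by auto
      then have "s \<in> A" "p \<in> ball s r" using \<open>p \<in> P\<close> by (auto simp: A_def dist_commute)
      then show "p \<in> (\<Union>s\<in>A. ball s r)" by blast
    qed
    then obtain S where S: "S \<subseteq> A" "finite S" "P \<subseteq> (\<Union>s\<in>S. ball s r)"
      using compactE_image[OF PR(1), of A "\<lambda>s. ball s r"] by auto
    have "S \<noteq> {}" using S PR by auto
    have "(S, n) \<in> \<F>" using S by (auto simp: \<F>_def A_def)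
    then obtain i where "from_nat_into \<F> i = (S, n)"
      using from_nat_into_surj[OF \<open>countable \<F>\<close>] by blast
    then have w: "w i x = max 0 (min 1 (infdist x S * N - 1))" for x
      by (simp add: w_def f_def N_def)
    have "w i x = 0" if x: "x \<in> P" for x
    proof -
      obtain s where "s \<in> S" "dist s x < r" using S(3) x by auto
      then have "infdist x S \<le> r" using infdist_le2[of s S x r] by (simp add: dist_commute)
      then have "infdist x S * N \<le> r * N" by (rule mult_right_mono) (simp add: N_def)
      then show ?thesis using \<open>r * N = 1\<close> unfolding w by simp
    qed
    moreover have "w i x = 1" if x: "x \<in> R" for x
    proof -
      have "2 * r \<le> dist x s" if s: "s \<in> S" for s
      proof -
        obtain p where p: "p \<in> P" "dist s p < r" using S(1) s by (auto simp: A_def)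
        have "d \<le> dist p x" using d p x by blast
        also have "\<dots> \<le> dist s p + dist x s" by (metis dist_commute dist_triangle3)
        finally show ?thesis using p \<open>r < d / 3\<close> by linarith
      qed
      then have "2 * r \<le> infdist x S"
        unfolding infdist_notempty[OF \<open>S \<noteq> {}\<close>] by (intro cINF_greatest \<open>S \<noteq> {}\<close>)
      then have "2 * r * N \<le> infdist x S * N" by (rule mult_right_mono) (simp add: N_def)
      then have "2 \<le> infdist x S * N" using \<open>r * N = 1\<close>
        by (simp only: mult.assoc mult_1_right)
      then show ?thesis unfolding w by simp
    qed
    ultimately show "\<exists>i. (\<forall>x\<in>P. w i x = 0) \<and> (\<forall>x\<in>R. w i x = 1)" by blast
  qed
qed

lemma W_le_aleph0_imp_fiberwise_injection:
  assumes "W_le_aleph0 X Y f"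
  obtains q :: "'a \<Rightarrow> nat \<Rightarrow> real"
  where "continuous_map X euclidean q" "\<And>y. inj_on q (fiber X f y)"
proof -
  obtain q where q: "continuous_map X hilbert_cube q"
    and emb: "embedding_map X (prod_topology Y hilbert_cube) (\<lambda>x. (f x, q x))"
    using assms unfolding W_le_aleph0_def by blast
  have "continuous_map X (product_topology (\<lambda>_. euclidean) UNIV) q"
    using q unfolding hilbert_cube_def continuous_map_componentwise_UNIV
    by (simp add: continuous_map_in_subtopology)
  then have "continuous_map X euclidean q" by (simp add: euclidean_product_topology)
  moreover have "inj_on (\<lambda>x. (f x, q x)) (topspace X)"
    using emb unfolding embedding_map_def by (rule homeomorphic_imp_injective_map)
  then have "inj_on q (fiber X f y)" for y
    by (auto simp: inj_on_def fiber_def)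
  ultimately show thesis by (rule that)
qed

lemma separates_closed_sets_compose_injection:
  assumes K: "compact_space K" and q: "continuous_map K euclidean q" and inj: "inj_on q (topspace K)"
    and w: "\<And>i. continuous_on UNIV (w i)" "\<And>i x. w i x \<in> {0..1}"
    "\<And>P R. \<lbrakk>compact P; compact R; P \<noteq> {}; R \<noteq> {}; P \<inter> R = {}\<rbrakk>
       \<Longrightarrow> \<exists>i. (\<forall>x\<in>P. w i x = 0) \<and> (\<forall>x\<in>R. w i x = 1)"
  shows "separates_closed_sets K (\<lambda>i x. w i (q x))"
  unfolding separates_closed_sets_def
proof (intro conjI allI impI)
  fix i
  show "continuous_map K euclideanreal (\<lambda>x. w i (q x))"
    using continuous_map_compose[OF q, of euclideanreal "w i"] w(1) by (simp add: o_def)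
  show "(\<lambda>x. w i (q x)) \<in> topspace K \<rightarrow> {0..1}" using w(2) by blast
next
  fix P R
  assume PR: "closedin K P \<and> closedin K R \<and> P \<noteq> {} \<and> R \<noteq> {} \<and> disjnt P R"
  have "compact (q ` P)" "compact (q ` R)"
    using PR closedin_compact_space[OF K] image_compactin[OF _ q] by force+
  moreover have "q ` P \<inter> q ` R = q ` (P \<inter> R)"
    using inj PR by (intro inj_on_image_Int[symmetric]) (auto dest: closedin_subset)
  then have "q ` P \<inter> q ` R = {}" using PR by (simp add: disjnt_def)
  ultimately show "\<exists>i. (\<forall>x\<in>P. w i (q x) = 0) \<and> (\<forall>x\<in>R. w i (q x) = 1)"
    using w(3)[of "q ` P" "q ` R"] PR by auto
qed

section \<open>Bing and Krasinkiewicz maps with crooked coordinates\<close>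

lemma subcontinuum_subtopology:
  "subcontinuum (subtopology X S) C \<longleftrightarrow> C \<subseteq> S \<and> subcontinuum X C"
  by (auto simp: subcontinuum_def subtopology_subtopology inf_absorb2)

lemma subcontinuumD:
  assumes "subcontinuum K C" "Hausdorff_space K"
  shows "closedin K C" "connectedin K C" "C \<noteq> {}"
proof -
  have C: "C \<subseteq> topspace K" "compact_space (subtopology K C)" "connected_space (subtopology K C)"
    "topspace (subtopology K C) \<noteq> {}"
    using assms by (auto simp: subcontinuum_def continuum_def compactum_def)
  then show "connectedin K C" "C \<noteq> {}" by (auto simp: connectedin_def)
  show "closedin K C"
    using C compactin_imp_closedin[OF assms(2)] by (simp add: compactin_subspace)
qed

text \<open>Any fiber of \<open>g\<close> lies in a fiber of the one coordinate. In a decomposition of a continuum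
into two proper subcontinua these meet and neither contains the other.\<close>

lemma Bing_map_of_crooked_coordinate:
  fixes g :: "'a \<Rightarrow> real ^ 'n"
  assumes v: "separates_closed_sets K v" and "compactum K"
    and g: "continuous_map K euclidean g" and k: "crooked K v (\<lambda>x. g x $ k)"
  shows "Bing_map K g"
proof -
  have K: "compact_space K" "metrizable_space K" "Hausdorff_space K"
    using \<open>compactum K\<close> by (auto simp: compactum_def metrizable_imp_Hausdorff_space)
  have "Bing_space (subtopology K (fiber K g z))" for z
  proof -
    have "closedin K (fiber K g z)"
      using closedin_continuous_map_preimage[OF g, of "{z}"] by (simp add: fiber_def)
    then have "compactum (subtopology K (fiber K g z))"
      using K by (simp add: compactum_def closedin_compact_space compact_space_subtopology
          metrizable_space_subtopology)
    moreover have "indecomposable_continuum (subtopology (subtopology K (fiber K g z)) C)"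
      if C: "subcontinuum (subtopology K (fiber K g z)) C" for C
    proof -
      have Cz: "C \<subseteq> fiber K g z" and KC: "subcontinuum K C"
        using C by (auto simp: subcontinuum_subtopology)
      have top: "topspace (subtopology K C) = C"
        using KC by (auto simp: subcontinuum_def)
      have eq: "subtopology (subtopology K (fiber K g z)) C = subtopology K C"
        using Cz by (simp add: subtopology_subtopology inf_absorb2)
      have "\<not> (subcontinuum (subtopology K C) A \<and> A \<noteq> C \<and>
               subcontinuum (subtopology K C) B \<and> B \<noteq> C \<and> A \<union> B = C)" for A B
      proof
        assume AB: "subcontinuum (subtopology K C) A \<and> A \<noteq> C \<and>
               subcontinuum (subtopology K C) B \<and> B \<noteq> C \<and> A \<union> B = C"
        then have "subcontinuum K A" "subcontinuum K B" by (auto simp: subcontinuum_subtopology)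
        note A = subcontinuumD[OF this(1) K(3)] and B = subcontinuumD[OF this(2) K(3)]
        have conn: "connectedin K (A \<union> B)" using AB subcontinuumD(2)[OF KC K(3)] by simp
        have "A \<inter> B \<noteq> {}"
        proof
          assume "A \<inter> B = {}"
          then have "\<exists>E1 E2. closedin K E1 \<and> closedin K E2 \<and> A \<union> B \<subseteq> E1 \<union> E2 \<and>
              E1 \<inter> E2 \<inter> (A \<union> B) = {} \<and> E1 \<inter> (A \<union> B) \<noteq> {} \<and> E2 \<inter> (A \<union> B) \<noteq> {}"
            using A(1,3) B(1,3) by (intro exI[of _ A] exI[of _ B]) auto
          then show False using conn by (simp add: connectedin_closedin)
        qed
        moreover have "g x $ k = z $ k" if "x \<in> A \<union> B" for x
          using that AB Cz by (auto simp: fiber_def)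
        ultimately have "A \<subseteq> B \<or> B \<subseteq> A"
          by (rule crooked_fiber_nested[OF v k Hausdorff_imp_t1_space[OF K(3)] A(1,2) B(1,2)])
        then show False using AB by auto
      qed
      then show ?thesis
        using KC unfolding eq indecomposable_continuum_def top by (auto simp: subcontinuum_def)
    qed
    ultimately show ?thesis by (simp add: Bing_space_def)
  qed
  then show ?thesis using K g by (simp add: Bing_map_def)
qed

text \<open>Here all coordinates have to be crooked, because it is not known in advance which of them is
nonconstant on a given continuum.\<close>

lemma Krasinkiewicz_map_of_crooked_coordinates:
  fixes g :: "'a \<Rightarrow> real ^ 'n"
  assumes v: "separates_closed_sets K v" and K: "compact_space K" "Hausdorff_space K"
    and g: "continuous_map K euclidean g" and crooked: "\<And>k. crooked K v (\<lambda>x. g x $ k)"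
  shows "Krasinkiewicz_map K g"
proof -
  have "(\<exists>z. C \<subseteq> fiber K g z) \<or>
        (\<exists>z. \<exists>D \<in> connected_components_of (subtopology K (fiber K g z)). D \<subseteq> C)"
    if "subcontinuum K C" for C
  proof -
    note C = subcontinuumD[OF that K(2)]
    have C_sub: "C \<subseteq> topspace K" using C(1) by (rule closedin_subset)
    show ?thesis
    proof (cases "\<forall>k. (\<lambda>x. g x $ k) constant_on C")
      case True
      obtain c where "c \<in> C" using C by blast
      then have "g x = g c" if "x \<in> C" for x
        using True that unfolding vec_eq_iff constant_on_def by metis
      then have "C \<subseteq> fiber K g (g c)" using C_sub by (auto simp: fiber_def)
      then show ?thesis by blast
    next
      case False
      then obtain k where "\<not> (\<lambda>x. g x $ k) constant_on C" by blast
      then obtain x where "x \<in> C"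
        and x: "\<And>D. \<lbrakk>connectedin K D; x \<in> D; (\<lambda>x. g x $ k) constant_on D\<rbrakk> \<Longrightarrow> D \<subseteq> C"
        using crooked_continuum_contains_component[OF v crooked[of k] K C(1,2)] by blast
      define T where "T = subtopology K (fiber K g (g x))"
      define D where "D = connected_component_of_set T x"
      have "x \<in> topspace T" using \<open>x \<in> C\<close> C_sub by (auto simp: T_def fiber_def)
      then have D: "D \<in> connected_components_of T"
        by (auto simp: D_def connected_components_of_def)
      have "connectedin T D" unfolding D_def by (rule connectedin_connected_component_of)
      then have "connectedin K D" "D \<subseteq> fiber K g (g x)"
        by (auto simp: T_def connectedin_subtopology)
      moreover have "x \<in> D" using \<open>x \<in> topspace T\<close> by (simp add: D_def connected_component_of_refl)
      moreover have "(\<lambda>x. g x $ k) constant_on D"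
        using \<open>D \<subseteq> fiber K g (g x)\<close> unfolding constant_on_def fiber_def by fastforce
      ultimately have "D \<subseteq> C" by (intro x)
      then show ?thesis using D unfolding T_def by blast
    qed
  qed
  then show ?thesis using K g by (simp add: Krasinkiewicz_map_def)
qed

section \<open>Density\<close>

lemma continuous_map_vec:
  fixes g :: "'a \<Rightarrow> real ^ 'n"
  assumes "\<And>k. continuous_map X euclideanreal (\<lambda>x. g x $ k)"
  shows "continuous_map X euclidean g"
  using assms by (auto simp: continuous_map_atin intro: vec_tendstoI)

lemma closure_of_eq_mspace:
  assumes "D \<subseteq> mspace m" "\<And>x r. \<lbrakk>x \<in> mspace m; r > 0\<rbrakk> \<Longrightarrow> \<exists>y\<in>D. mdist m x y < r"
  shows "mtopology_of m closure_of D = mspace m"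
proof -
  interpret Metric_space "mspace m" "mdist m" by (rule Metric_space_mspace_mdist)
  show ?thesis
    unfolding mtopology_of_def metric_closure_of in_mball using assms by blast
qed

theorem corollary1p4:
  fixes X :: "'a topology" and Y :: "'b topology" and f :: "'a \<Rightarrow> 'b"
  assumes "paracompact_space X" and "Hausdorff_space X"
    and "paracompact_space Y" and "Hausdorff_space Y"
    and "continuous_map X Y f"
    and "\<And>y. y \<in> topspace Y \<Longrightarrow> compactin X (fiber X f y)"
    and "W_le_aleph0 X Y f"
  shows "\<exists>D \<subseteq> mspace (cfunspace X (euclidean_metric :: (real ^ 'n) metric)).
           mtopology_of (cfunspace X euclidean_metric) closure_of D
             = mspace (cfunspace X euclidean_metric) \<and>
           (\<forall>g\<in>D. \<forall>y\<in>topspace Y.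
              Bing_map (subtopology X (fiber X f y)) g \<and>
              Krasinkiewicz_map (subtopology X (fiber X f y)) g)"
proof -
  obtain q :: "'a \<Rightarrow> nat \<Rightarrow> real" where q: "continuous_map X euclidean q"
    and inj: "\<And>y. inj_on q (fiber X f y)"
    using W_le_aleph0_imp_fiberwise_injection[OF assms(7)] by blast
  obtain w :: "nat \<Rightarrow> (nat \<Rightarrow> real) \<Rightarrow> real"
    where w: "\<And>i. continuous_on UNIV (w i)" "\<And>i x. w i x \<in> {0..1}"
    "\<And>P R. \<lbrakk>compact P; compact R; P \<noteq> {}; R \<noteq> {}; P \<inter> R = {}\<rbrakk>
       \<Longrightarrow> \<exists>i. (\<forall>x\<in>P. w i x = 0) \<and> (\<forall>x\<in>R. w i x = 1)"
    using exists_separating_functions by blast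
  define v where "v = (\<lambda>i x. w i (q x))"
  have v: "continuous_map X euclideanreal (v i)" for i
    using continuous_map_compose[OF q, of euclideanreal "w i"] w(1) by (simp add: v_def o_def)
  let ?m = "cfunspace X (euclidean_metric :: (real ^ 'n) metric)"
  define D where "D = {g \<in> mspace ?m. \<forall>k. crooked X v (\<lambda>x. g x $ k)}"
  have D_sub: "D \<subseteq> mspace ?m" unfolding D_def by (rule Collect_restrict)
  have "Bing_map (subtopology X (fiber X f y)) g \<and> Krasinkiewicz_map (subtopology X (fiber X f y)) g"
    if "g \<in> D" and y: "y \<in> topspace Y" for g y
  proof -
    define K where "K = subtopology X (fiber X f y)"
    have top: "topspace K = fiber X f y" by (auto simp: K_def fiber_def)
    have K: "compact_space K" "Hausdorff_space K"
      using assms(6)[OF y] \<open>Hausdorff_space X\<close>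
      by (auto simp: K_def compact_space_subtopology Hausdorff_space_subtopology)
    have qK: "continuous_map K euclidean q" using q by (simp add: K_def continuous_map_from_subtopology)
    have "embedding_map K euclidean q"
      using continuous_imp_embedding_map[OF qK K(1)] inj by (simp add: top)
    then have "K homeomorphic_space subtopology euclidean (q ` topspace K)"
      by (rule embedding_map_imp_homeomorphic_space)
    then have "metrizable_space K"
      by (simp add: homeomorphic_metrizable_space metrizable_space_subtopology
          metrizable_space_euclidean)
    moreover have "separates_closed_sets K v"
      unfolding v_def
      by (rule separates_closed_sets_compose_injection[OF K(1) qK _ w]) (simp_all add: top inj)
    moreover have "continuous_map K euclidean g" "crooked K v (\<lambda>x. g x $ k)" for k
      using \<open>g \<in> D\<close> by (auto simp: D_def K_def continuous_map_from_subtopology crooked_subtopology)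
    ultimately show ?thesis
      using K Bing_map_of_crooked_coordinate[of K v g]
        Krasinkiewicz_map_of_crooked_coordinates[of K v g]
      unfolding K_def[symmetric] compactum_def by simp
  qed
  moreover have "mtopology_of ?m closure_of D = mspace ?m"
  proof -
    have "\<exists>g\<in>D. mdist ?m \<phi> g < r" if \<phi>: "\<phi> \<in> mspace ?m" and "r > 0" for \<phi> r
    proof -
      have \<phi>_cont: "continuous_map X euclidean \<phi>" and bdd: "bounded (\<phi> ` topspace X)"
        using \<phi> by auto
      \<comment> \<open>The Euclidean norm is at most the sum of the absolute values of the coordinates.\<close>
      define c where "c = r / (2 * real CARD('n))"
      have "c > 0" using \<open>r > 0\<close> by (simp add: c_def)
      have "continuous_map X euclideanreal (\<lambda>x. \<phi> x $ k)" for k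
        using continuous_map_compose[OF \<phi>_cont, of euclideanreal "\<lambda>x. x $ k"]
        by (simp add: o_def continuous_on_component)
      then have "\<exists>g. crooked X v g \<and> (\<forall>x\<in>topspace X. \<bar>g x - \<phi> x $ k\<bar> \<le> c)" for k
        using exists_crooked_approximation[of X "\<lambda>x. \<phi> x $ k" v c] v w(2) \<open>c > 0\<close>
        unfolding v_def by metis
      then obtain G where G: "\<And>k. crooked X v (G k)"
        and near: "\<And>k x. x \<in> topspace X \<Longrightarrow> \<bar>G k x - \<phi> x $ k\<bar> \<le> c"
        by metis
      define g where "g = restrict (\<lambda>x. \<chi> k. G k x) (topspace X)"
      have g_crooked: "crooked X v (\<lambda>x. g x $ k)" for k
        using G by (rule crooked_eq) (simp add: g_def)
      then have "continuous_map X euclidean g"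
        by (intro continuous_map_vec) (simp add: crooked_def)
      moreover have dist: "dist (\<phi> x) (g x) \<le> r / 2" if "x \<in> topspace X" for x
      proof -
        have "norm (\<phi> x - g x) \<le> (\<Sum>k\<in>UNIV. \<bar>(\<phi> x - g x) $ k\<bar>)" by (rule norm_le_l1_cart)
        also have "\<dots> \<le> (\<Sum>k\<in>(UNIV :: 'n set). c)"
          using near[OF that] that by (intro sum_mono) (simp add: g_def abs_minus_commute)
        also have "\<dots> = r / 2" by (simp add: c_def)
        finally show ?thesis by (simp add: dist_norm)
      qed
      moreover have "bounded (g ` topspace X)"
      proof -
        obtain B where "\<And>x. x \<in> topspace X \<Longrightarrow> norm (\<phi> x) \<le> B"
          using bdd by (auto simp: bounded_iff)
        then have "norm (g x) \<le> B + r / 2" if "x \<in> topspace X" for x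
          using dist[OF that] that norm_triangle_sub[of "g x" "\<phi> x"]
          by (fastforce simp: dist_norm norm_minus_commute)
        then show ?thesis by (auto simp: bounded_iff)
      qed
      ultimately have "g \<in> mspace ?m" by (simp add: g_def)
      then have "g \<in> D" using g_crooked by (simp add: D_def)
      moreover have "mdist ?m \<phi> g \<le> r / 2"
        using dist \<open>r > 0\<close> by (intro mdist_cfunspace_le) auto
      ultimately show ?thesis using \<open>r > 0\<close> by (intro bexI[of _ g]) auto
    qed
    with D_sub show ?thesis by (rule closure_of_eq_mspace)
  qed
  ultimately show ?thesis using D_sub by blast
qed

end
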